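(* Let $u, v \in A^*$. Then $u \equiv_{\mathrm{B}} v$ if and only if $u \equiv_{\mathrm{S}} v$ and $u \equiv_{\mathrm{S}^\#} v$.
   Context: $A = \{a_1 < a_2 < \cdots\}$ is a totally ordered infinite alphabet and $A^*$ is the free monoid of words on $A$. A congruence on $A^*$ is an equivalence relation compatible with concatenation. The Baxter congruence $\equiv_{\mathrm{B}}$ is the smallest congruence on $A^*$ such that, for all words $u, v \in A^*$ and letters $a,b,c,d \in A$: $\; c\,u\,a d\,v\,b \equiv_{\mathrm{B}} c\,u\,d a\,v\,b$ whenever $a \leq b < c \leq d$, and $\; b\,u\,d a\,v\,c \equiv_{\mathrm{B}} b\,u\,a d\,v\,c$ whenever $a < b \leq c < d$. The sylvester congruence $\equiv_{\mathrm{S}}$ is the smallest congruence on $A^*$ such that $a c\,u\,b \equiv_{\mathrm{S}} c a\,u\,b$ for all $u \in A^*$ and letters $a \leq b < c$. The $\#$-sylvester congruence $\equiv_{\mathrm{S}^\#}$ is the smallest congruence on $A^*$ such that $b\,u\,a c \equiv_{\mathrm{S}^\#} b\,u\,c a$ for all $u \in A^*$ and letters $a < b \leq c$. *)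

theory Defs
  imports Main
begin

text \<open>Words over an alphabet are lists over a linearly ordered type, the monoid operation being append.\<close>

definition congruence :: "('a list \<times> 'a list) set \<Rightarrow> bool" where
  "congruence r \<longleftrightarrow> equiv UNIV r \<and>
     (\<forall>u u' v v'. (u, u') \<in> r \<longrightarrow> (v, v') \<in> r \<longrightarrow> (u @ v, u' @ v') \<in> r)"

definition generated_congruence :: "('a list \<times> 'a list) set \<Rightarrow> ('a list \<times> 'a list) set" where
  "generated_congruence R = \<Inter> {r. congruence r \<and> R \<subseteq> r}"

lemma subset_generated_congruence: "R \<subseteq> generated_congruence R"
  by (auto simp: generated_congruence_def)

lemma generated_congruence_least:
  "congruence r \<Longrightarrow> R \<subseteq> r \<Longrightarrow> generated_congruence R \<subseteq> r"
  by (auto simp: generated_congruence_def)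

lemma congruence_generated_congruence: "congruence (generated_congruence R)"
  unfolding congruence_def
proof (intro conjI allI impI)
  show "equiv UNIV (generated_congruence R)"
  proof (rule equivI)
    show "refl (generated_congruence R)"
      by (auto simp: refl_on_def generated_congruence_def congruence_def equiv_def)
    show "sym (generated_congruence R)"
      by (rule symI) (auto simp: generated_congruence_def congruence_def equiv_def dest: symD)
    show "trans (generated_congruence R)"
      by (rule transI) (auto simp: generated_congruence_def congruence_def equiv_def dest: transD)
  qed auto
next
  fix u u' v v' :: "'a list"
  assume "(u, u') \<in> generated_congruence R" "(v, v') \<in> generated_congruence R"
  then show "(u @ v, u' @ v') \<in> generated_congruence R"
    by (auto simp: generated_congruence_def congruence_def)
qed

definition baxter_rel :: "('a::linorder list \<times> 'a list) set" where
  "baxter_rel =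
     {([c] @ u @ [a, d] @ v @ [b], [c] @ u @ [d, a] @ v @ [b]) | a b c d u v.
        a \<le> b \<and> b < c \<and> c \<le> d} \<union>
     {([b] @ u @ [d, a] @ v @ [c], [b] @ u @ [a, d] @ v @ [c]) | a b c d u v.
        a < b \<and> b \<le> c \<and> c < d}"

definition sylvester_rel :: "('a::linorder list \<times> 'a list) set" where
  "sylvester_rel = {([a, c] @ u @ [b], [c, a] @ u @ [b]) | a b c u. a \<le> b \<and> b < c}"

definition hash_sylvester_rel :: "('a::linorder list \<times> 'a list) set" where
  "hash_sylvester_rel = {([b] @ u @ [a, c], [b] @ u @ [c, a]) | a b c u. a < b \<and> b \<le> c}"

definition baxter_cong :: "'a::linorder list \<Rightarrow> 'a list \<Rightarrow> bool"  (infix "\<equiv>\<^sub>B" 50) where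
  "u \<equiv>\<^sub>B v \<longleftrightarrow> (u, v) \<in> generated_congruence baxter_rel"

definition sylvester_cong :: "'a::linorder list \<Rightarrow> 'a list \<Rightarrow> bool"  (infix "\<equiv>\<^sub>S" 50) where
  "u \<equiv>\<^sub>S v \<longleftrightarrow> (u, v) \<in> generated_congruence sylvester_rel"

definition hash_sylvester_cong :: "'a::linorder list \<Rightarrow> 'a list \<Rightarrow> bool"  (infix "\<equiv>\<^sub>S\<^sub>#" 50) where
  "u \<equiv>\<^sub>S\<^sub># v \<longleftrightarrow> (u, v) \<in> generated_congruence hash_sylvester_rel"

end

theory Submission
  imports Defs "HOL-Library.Multiset"
begin

text \<open>
  A sylvester move swaps two letters \<open>a < c\<close> when some \<open>b\<close> with \<open>a \<le> b < c\<close> occurs to their right,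
  a \<open>#\<close>-sylvester move does so when some \<open>b\<close> with \<open>a < b \<le> c\<close> occurs to their left, and a Baxter
  move is exactly a swap for which both witnesses are present. For the nontrivial direction, \<open>u\<close> is
  transformed into \<open>v\<close> from left to right: the next letter \<open>x\<close> of \<open>v\<close> is brought into place in \<open>u\<close>
  by swapping it with its left neighbours. Each of these swaps has both witnesses, because otherwise
  one of two invariants would distinguish \<open>u\<close> from \<open>v\<close>: the number of letters \<open>c\<close> after the last
  letter in \<open>{a..<c}\<close> (sylvester), and the number of letters \<open>a\<close> before the first letter in
  \<open>{a<..c}\<close> (\<open>#\<close>-sylvester).
\<close>

section \<open>Congruences and swaps of adjacent letters\<close>

lemma congruence_intros:
  assumes "congruence r"
  shows congruence_refl: "(u, u) \<in> r"
    and congruence_sym: "(u, v) \<in> r \<Longrightarrow> (v, u) \<in> r"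
    and congruence_trans: "(u, v) \<in> r \<Longrightarrow> (v, w) \<in> r \<Longrightarrow> (u, w) \<in> r"
    and congruence_append: "(u, v) \<in> r \<Longrightarrow> (u', v') \<in> r \<Longrightarrow> (u @ u', v @ v') \<in> r"
proof -
  have "equiv UNIV r"
    and app: "\<And>u u' v v'. (u, u') \<in> r \<Longrightarrow> (v, v') \<in> r \<Longrightarrow> (u @ v, u' @ v') \<in> r"
    using assms by (simp_all add: congruence_def)
  then have "refl r" "sym r" "trans r"
    by (auto elim: equivE)
  then show "(u, u) \<in> r" "(u, v) \<in> r \<Longrightarrow> (v, u) \<in> r" "(u, v) \<in> r \<Longrightarrow> (v, w) \<in> r \<Longrightarrow> (u, w) \<in> r"
    by (blast dest: refl_onD symD transD)+
  show "(u, v) \<in> r \<Longrightarrow> (u', v') \<in> r \<Longrightarrow> (u @ u', v @ v') \<in> r"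
    by (rule app)
qed

lemma congruence_in_context:
  assumes "congruence r" "(u, v) \<in> r"
  shows "(p @ u @ q, p @ v @ q) \<in> r"
  using assms by (intro congruence_append congruence_refl)

text \<open>This makes it enough to check swaps with witnesses on both sides. In the first Baxter
  family the swapped letters are \<open>a\<close> and \<open>d\<close>, with \<open>c\<close> as
  left and \<open>b\<close> as right witness; in the second, \<open>b\<close> is the left and
  \<open>c\<close> the right witness, and the swap runs backwards, whence the symmetry.\<close>

lemma baxter_subset:
  fixes r :: "('a::linorder list \<times> 'a list) set"
  assumes r: "congruence r"
    and swap: "\<And>a b b' c p q. a \<le> b \<Longrightarrow> b < c \<Longrightarrow> a < b' \<Longrightarrow> b' \<le> c \<Longrightarrow>
      b \<in> set q \<Longrightarrow> b' \<in> set p \<Longrightarrow> (p @ [a, c] @ q, p @ [c, a] @ q) \<in> r"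
  shows "generated_congruence baxter_rel \<subseteq> r"
proof (rule generated_congruence_least[OF r], unfold baxter_rel_def, intro Un_least subsetI)
  fix z :: "'a list \<times> 'a list"
  assume "z \<in> {([c] @ u @ [a, d] @ v @ [b], [c] @ u @ [d, a] @ v @ [b]) | a b c d u v.
        a \<le> b \<and> b < c \<and> c \<le> d}"
  then obtain a b c d u v
    where z: "z = (([c] @ u) @ [a, d] @ v @ [b], ([c] @ u) @ [d, a] @ v @ [b])"
      and "a \<le> b" "b < c" "c \<le> d" by auto
  then show "z \<in> r"
    unfolding z by (intro swap[of a b d c]) auto
next
  fix z :: "'a list \<times> 'a list"
  assume "z \<in> {([b] @ u @ [d, a] @ v @ [c], [b] @ u @ [a, d] @ v @ [c]) | a b c d u v.
        a < b \<and> b \<le> c \<and> c < d}"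
  then obtain a b c d u v
    where z: "z = (([b] @ u) @ [d, a] @ v @ [c], ([b] @ u) @ [a, d] @ v @ [c])"
      and "a < b" "b \<le> c" "c < d" by auto
  then show "z \<in> r"
    unfolding z by (intro congruence_sym[OF r swap[of a c d b]]) auto
qed

lemma sylvester_swap:
  assumes "a \<le> b" "b < c" "b \<in> set q"
  shows "p @ [a, c] @ q \<equiv>\<^sub>S p @ [c, a] @ q"
proof -
  obtain s t where q: "q = s @ [b] @ t"
    using assms(3) by (auto dest: split_list)
  have "([a, c] @ s @ [b], [c, a] @ s @ [b]) \<in> generated_congruence sylvester_rel"
    using assms by (intro subsetD[OF subset_generated_congruence]) (auto simp: sylvester_rel_def)
  from congruence_in_context[OF congruence_generated_congruence this, of p t] show ?thesis
    by (simp add: sylvester_cong_def q)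
qed

lemma hash_sylvester_swap:
  assumes "a < b" "b \<le> c" "b \<in> set p"
  shows "p @ [a, c] @ q \<equiv>\<^sub>S\<^sub># p @ [c, a] @ q"
proof -
  obtain s t where p: "p = s @ [b] @ t"
    using assms(3) by (auto dest: split_list)
  have "([b] @ t @ [a, c], [b] @ t @ [c, a]) \<in> generated_congruence hash_sylvester_rel"
    using assms
    by (intro subsetD[OF subset_generated_congruence]) (auto simp: hash_sylvester_rel_def)
  from congruence_in_context[OF congruence_generated_congruence this, of s q] show ?thesis
    by (simp add: hash_sylvester_cong_def p)
qed

text \<open>The two Baxter families correspond to the two possible orders of the witnesses: the
  first has the right witness \<open>b\<close> strictly below the left witness \<open>b'\<close>,
  the second has \<open>b'\<close> \<le> \<open>b\<close>. Together they cover every swap with a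
  witness on each side.\<close>

lemma baxter_swap:
  assumes "a \<le> b" "b < c" "b \<in> set q" "a < b'" "b' \<le> c" "b' \<in> set p"
  shows "p @ [a, c] @ q \<equiv>\<^sub>B p @ [c, a] @ q"
proof -
  obtain s t where q: "q = s @ [b] @ t"
    using assms(3) by (auto dest: split_list)
  obtain s' t' where p: "p = s' @ [b'] @ t'"
    using assms(6) by (auto dest: split_list)
  let ?l = "[b'] @ t' @ [a, c] @ s @ [b]" and ?r = "[b'] @ t' @ [c, a] @ s @ [b]"
  have "(?l, ?r) \<in> baxter_rel \<or> (?r, ?l) \<in> baxter_rel"
  proof (cases "b < b'")
    case True
    with assms have "\<exists>a' b'' c' d u v. (?l, ?r) =
        ([c'] @ u @ [a', d] @ v @ [b''], [c'] @ u @ [d, a'] @ v @ [b'']) \<and>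
        a' \<le> b'' \<and> b'' < c' \<and> c' \<le> d"
      by metis
    then show ?thesis
      unfolding baxter_rel_def by (intro disjI1 UnI1 CollectI)
  next
    case False
    then have "b' \<le> b" by simp
    with assms have "\<exists>a' b'' c' d u v. (?r, ?l) =
        ([b''] @ u @ [d, a'] @ v @ [c'], [b''] @ u @ [a', d] @ v @ [c']) \<and>
        a' < b'' \<and> b'' \<le> c' \<and> c' < d"
      by metis
    then show ?thesis
      unfolding baxter_rel_def by (intro disjI2 UnI2 CollectI)
  qed
  then have "(?l, ?r) \<in> generated_congruence baxter_rel"
    using subset_generated_congruence congruence_sym[OF congruence_generated_congruence] by blast
  from congruence_in_context[OF congruence_generated_congruence this, of s' t] show ?thesis
    by (simp add: baxter_cong_def p q)
qed

lemma baxter_imp_sylvester: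
  assumes "u \<equiv>\<^sub>B v"
  shows "u \<equiv>\<^sub>S v"
proof -
  have "generated_congruence baxter_rel \<subseteq> generated_congruence sylvester_rel"
    by (rule baxter_subset[OF congruence_generated_congruence])
      (rule sylvester_swap[unfolded sylvester_cong_def])
  then show ?thesis
    using assms by (auto simp: baxter_cong_def sylvester_cong_def)
qed

lemma baxter_imp_hash_sylvester:
  assumes "u \<equiv>\<^sub>B v"
  shows "u \<equiv>\<^sub>S\<^sub># v"
proof -
  have "generated_congruence baxter_rel \<subseteq> generated_congruence hash_sylvester_rel"
    by (rule baxter_subset[OF congruence_generated_congruence])
      (rule hash_sylvester_swap[unfolded hash_sylvester_cong_def])
  then show ?thesis
    using assms by (auto simp: baxter_cong_def hash_sylvester_cong_def)
qed

section \<open>Invariants that count letters before an interval is reached\<close>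

definition count_before :: "'a set \<Rightarrow> 'a \<Rightarrow> 'a list \<Rightarrow> nat" where
  "count_before I x u = count (mset (takeWhile (\<lambda>y. y \<notin> I) u)) x"

lemma count_before_simps [simp]:
  "count_before I x [] = 0"
  "count_before I x (y # u) =
    (if y \<in> I then 0 else (if y = x then 1 else 0) + count_before I x u)"
  by (simp_all add: count_before_def)

lemma count_before_append:
  "count_before I x (u @ v) =
    (if set u \<inter> I = {} then count (mset u) x + count_before I x v else count_before I x u)"
  by (induction u) auto

lemma count_before_le: "count_before I x u \<le> count (mset u) x"
  by (induction u) auto

lemma count_before_append_le:
  "y \<in> I \<Longrightarrow> count_before I x (u @ y # v) \<le> count (mset u) x"
  by (simp add: count_before_append count_before_le)

lemma count_before_append_ge:
  "set u \<inter> I = {} \<Longrightarrow> count (mset u) x \<le> count_before I x (u @ v)"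
  by (simp add: count_before_append)

text \<open>By \<open>count_before_append\<close>, the count of a concatenation depends on the first
  factor also through its set of letters and its multiplicities. Equality of multisets therefore has
  to be part of the relation to make it compatible with concatenation.\<close>

lemma congruence_count_before:
  "congruence {(u, v). mset u = mset v \<and> (\<forall>(I, x)\<in>K. count_before I x u = count_before I x v)}"
  (is "congruence ?r")
  unfolding congruence_def
proof (intro conjI allI impI)
  show "equiv UNIV ?r"
  proof (rule equivI)
    show "trans ?r"
      by (rule transI) (auto split: prod.splits)
  qed (auto simp: refl_on_def sym_def)
next
  fix u u' v v'
  assume "(u, u') \<in> ?r" "(v, v') \<in> ?r"
  moreover from this have "set u = set u'"
    by (auto dest: mset_eq_setD)
  ultimately show "(u @ v, u' @ v') \<in> ?r"
    by (fastforce simp: count_before_append)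
qed

text \<open>The sylvester invariant counts from the right end of a word, so it is obtained from
  \<open>count_before\<close> by reversal.\<close>

lemma congruence_rev:
  assumes "congruence r"
  shows "congruence {(u, v). (rev u, rev v) \<in> r}"
  unfolding congruence_def
proof (intro conjI allI impI)
  show "equiv UNIV {(u, v). (rev u, rev v) \<in> r}"
    by (intro equivI refl_onI symI transI)
      (auto intro: congruence_refl[OF assms] congruence_sym[OF assms] congruence_trans[OF assms])
qed (auto intro: congruence_append[OF assms])

lemma sylvester_invariant:
  fixes u v :: "'a::linorder list"
  assumes "u \<equiv>\<^sub>S v"
  shows "mset u = mset v" "count_before {a..<c} c (rev u) = count_before {a..<c} c (rev v)"
proof -
  \<comment> \<open>For a generator swapping \<open>a\<close> and \<open>c\<close>, the count can
    change only if the counted letter is \<open>c\<close> and \<open>a\<close> lies in the interval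
    below it. Then the witness \<open>b\<close>, being in {a..<c}, lies in that interval too, and
    the reversed word reaches it before the swapped pair.\<close>
  have "generated_congruence sylvester_rel \<subseteq> {(u, v). (rev u, rev v) \<in> {(u, v). mset u = mset v \<and>
     (\<forall>(I, x)\<in>{({a..<c}, c :: 'a) | a c. True}. count_before I x u = count_before I x v)}}"
    by (rule generated_congruence_least[OF congruence_rev[OF congruence_count_before]])
      (auto simp: sylvester_rel_def count_before_append)
  then show "mset u = mset v" "count_before {a..<c} c (rev u) = count_before {a..<c} c (rev v)"
    using assms by (auto simp: sylvester_cong_def)
qed

lemma hash_sylvester_invariant:
  fixes u v :: "'a::linorder list"
  assumes "u \<equiv>\<^sub>S\<^sub># v"
  shows "count_before {a<..c} a u = count_before {a<..c} a v"
proof -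
  \<comment> \<open>Dually, a change would require counting \<open>a\<close> with \<open>c\<close>
    in the interval; that interval then contains the witness \<open>b\<close>, which stands to the
    left of the swapped pair.\<close>
  have "generated_congruence hash_sylvester_rel \<subseteq> {(u, v). mset u = mset v \<and>
     (\<forall>(I, x)\<in>{({a<..c}, a :: 'a) | a c. True}. count_before I x u = count_before I x v)}"
    by (rule generated_congruence_least[OF congruence_count_before])
      (auto simp: hash_sylvester_rel_def count_before_append)
  then show ?thesis
    using assms by (auto simp: hash_sylvester_cong_def)
qed

section \<open>Witnesses forced by the invariants\<close>

lemma sylvester_right_witness:
  assumes S: "w @ p @ [y, x] @ q \<equiv>\<^sub>S w @ x # v" and "x \<notin> set p" "y \<noteq> x"
  shows "\<exists>b\<in>set q. min x y \<le> b \<and> b < max x y"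
proof (rule ccontr)
  assume none: "\<not> ?thesis"
  have v: "mset v = mset p + {#y#} + mset q"
    using sylvester_invariant(1)[OF S] by simp
  then have "y \<in> set v"
    by (metis set_mset_mset union_iff union_single_eq_member)
  note inv = sylvester_invariant(2)[OF S]
  show False
  proof (cases "y < x")
    case True
    obtain s t where st: "v = s @ y # t"
      using \<open>y \<in> set v\<close> by (auto dest: split_list)
    \<comment> \<open>Seen from the right, the first word shows all \<open>x\<close> of
      \<open>q\<close> and the displayed \<open>x\<close> before any letter of {y..<x}. The second
      word is stopped inside \<open>v\<close>, at the latest by a \<open>y\<close>, and
      \<open>v\<close> has only as many \<open>x\<close> as \<open>q\<close>.\<close>
    have "count (mset q) x + 1 = count (mset (rev q @ [x])) x" by simp
    also have "\<dots> \<le> count_before {y..<x} x (rev (w @ p @ [y, x] @ q))"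
      using count_before_append_ge[of "rev q @ [x]" "{y..<x}" x "y # rev p @ rev w"] none True
      by (auto simp: disjoint_iff)
    also have "\<dots> = count_before {y..<x} x (rev (w @ x # v))" by (rule inv)
    also have "\<dots> \<le> count (mset (rev t)) x"
      using count_before_append_le[of y "{y..<x}" x "rev t" "rev (w @ x # s)"] True by (simp add: st)
    also have "\<dots> \<le> count (mset v) x" by (simp add: st)
    also have "\<dots> = count (mset q) x"
      using \<open>x \<notin> set p\<close> \<open>y \<noteq> x\<close> by (simp add: v count_mset_0_iff)
    finally show False by simp
  next
    case False
    then have "x < y" using \<open>y \<noteq> x\<close> by simp
    then have "x \<notin> set q" using none by auto
    then have "x \<notin> set v"
      using v \<open>x \<notin> set p\<close> \<open>y \<noteq> x\<close> by (auto dest!: arg_cong[of _ _ set_mset])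
    \<comment> \<open>Counting \<open>y\<close> itself may fail, since letters of \<open>p\<close>,
      which recur in \<open>v\<close>, can lie in {x..<y} and stop the count early. With the least
      letter \<open>e\<close> of \<open>v\<close> in {x..y}, the interval {x..<e} misses
      \<open>v\<close>, so all \<open>e\<close> of \<open>v\<close> are counted, whereas the other
      word is stopped by its displayed \<open>x\<close>.\<close>
    define e where "e = Min (set v \<inter> {x..y})"
    have "e \<in> set v \<inter> {x..y}"
      unfolding e_def using \<open>y \<in> set v\<close> \<open>x < y\<close> by (intro Min_in) auto
    then have e: "e \<in> set v" "x < e" "e \<le> y"
      using \<open>x \<notin> set v\<close> by (auto simp: order.order_iff_strict)
    have e_min: "set v \<inter> {x..<e} = {}"
    proof -
      have "e \<le> z" if "z \<in> set v" "x \<le> z" "z < e" for z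
        unfolding e_def using that e by (intro Min_le) auto
      then show ?thesis by fastforce
    qed
    \<comment> \<open>If \<open>e\<close> = \<open>y\<close>, the displayed \<open>y\<close> is one
      more occurrence in \<open>v\<close> than in \<open>q\<close>; otherwise \<open>e\<close> lies
      in {x..<y}, hence is absent from \<open>q\<close>.\<close>
    have "count (mset q) e < count (mset v) e"
    proof (cases "e = y")
      case True
      then show ?thesis by (simp add: v)
    next
      case False
      then have "e \<notin> set q" using none e \<open>x < y\<close> by auto
      then have "count (mset q) e = 0" "count (mset v) e \<noteq> 0"
        using e(1) by (simp_all add: count_mset_0_iff)
      then show ?thesis by linarith
    qed
    also have "\<dots> \<le> count_before {x..<e} e (rev (w @ x # v))"
      using count_before_append_ge[of "rev v" "{x..<e}" e "x # rev w"] e_min by simp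
    also have "\<dots> = count_before {x..<e} e (rev (w @ p @ [y, x] @ q))" by (rule inv[symmetric])
    also have "\<dots> \<le> count (mset q) e"
      using count_before_append_le[of x "{x..<e}" e "rev q" "y # rev p @ rev w"] e by simp
    finally show False by simp
  qed
qed

text \<open>No auxiliary letter is needed here, because from the left both words begin with
  \<open>w\<close>. If \<open>y\<close> < \<open>x\<close>, the second word stops at the
  \<open>x\<close> right after \<open>w\<close> and misses the displayed \<open>y\<close>; if
  \<open>x\<close> < \<open>y\<close>, the first word stops no later than the displayed
  \<open>y\<close>, before any \<open>x\<close> beyond those of \<open>w\<close>.\<close>

lemma hash_sylvester_left_witness:
  assumes S: "w @ p @ [y, x] @ q \<equiv>\<^sub>S\<^sub># w @ x # v" and "x \<notin> set p" "y \<noteq> x"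
  shows "\<exists>b\<in>set (w @ p). min x y < b \<and> b \<le> max x y"
proof (rule ccontr)
  assume none: "\<not> ?thesis"
  note inv = hash_sylvester_invariant[OF S]
  show False
  proof (cases "y < x")
    case True
    have "count (mset w) y + 1 \<le> count (mset (w @ p @ [y])) y" by simp
    also have "\<dots> \<le> count_before {y<..x} y (w @ p @ [y, x] @ q)"
      using count_before_append_ge[of "w @ p @ [y]" "{y<..x}" y "x # q"] none True
      by (auto simp: disjoint_iff)
    also have "\<dots> = count_before {y<..x} y (w @ x # v)" by (rule inv)
    also have "\<dots> \<le> count (mset w) y"
      using True by (intro count_before_append_le) simp
    finally show False by simp
  next
    case False
    then have "x < y" using \<open>y \<noteq> x\<close> by simp
    have "count (mset w) x + 1 = count (mset (w @ [x])) x" by simp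
    also have "\<dots> \<le> count_before {x<..y} x (w @ x # v)"
      using count_before_append_ge[of "w @ [x]" "{x<..y}" x v] none \<open>x < y\<close>
      by (auto simp: disjoint_iff)
    also have "\<dots> = count_before {x<..y} x (w @ p @ [y, x] @ q)" by (rule inv[symmetric])
    also have "\<dots> \<le> count (mset (w @ p)) x"
      using count_before_append_le[of y "{x<..y}" x "w @ p" "x # q"] \<open>x < y\<close> by simp
    also have "\<dots> = count (mset w) x"
      using \<open>x \<notin> set p\<close> by (simp add: count_mset_0_iff)
    finally show False by simp
  qed
qed

section \<open>Transforming one word into the other by Baxter swaps\<close>

lemmas baxter_sym =
  congruence_sym[OF congruence_generated_congruence[of baxter_rel], folded baxter_cong_def]
lemmas baxter_trans =
  congruence_trans[OF congruence_generated_congruence[of baxter_rel], folded baxter_cong_def]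
lemmas sylvester_sym =
  congruence_sym[OF congruence_generated_congruence[of sylvester_rel], folded sylvester_cong_def]
lemmas sylvester_trans =
  congruence_trans[OF congruence_generated_congruence[of sylvester_rel], folded sylvester_cong_def]
lemmas hash_sylvester_sym =
  congruence_sym[OF congruence_generated_congruence[of hash_sylvester_rel],
    folded hash_sylvester_cong_def]
lemmas hash_sylvester_trans =
  congruence_trans[OF congruence_generated_congruence[of hash_sylvester_rel],
    folded hash_sylvester_cong_def]

lemma baxter_move_letter:
  assumes "w @ p @ x # q \<equiv>\<^sub>S w @ x # v" "w @ p @ x # q \<equiv>\<^sub>S\<^sub># w @ x # v" "x \<notin> set p"
  shows "w @ p @ x # q \<equiv>\<^sub>B w @ x # p @ q"
  using assms
proof (induction p arbitrary: q rule: rev_induct)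
  case Nil
  show ?case
    by (simp add: baxter_cong_def congruence_refl[OF congruence_generated_congruence])
next
  case (snoc y p)
  then have S: "w @ p @ [y, x] @ q \<equiv>\<^sub>S w @ x # v" and H: "w @ p @ [y, x] @ q \<equiv>\<^sub>S\<^sub># w @ x # v"
    and x: "x \<notin> set p" "y \<noteq> x" by auto
  obtain b where b: "b \<in> set q" "min x y \<le> b" "b < max x y"
    using sylvester_right_witness[OF S x] by blast
  obtain b' where b': "b' \<in> set (w @ p)" "min x y < b'" "b' \<le> max x y"
    using hash_sylvester_left_witness[OF H x] by blast
  have step: "w @ p @ [y, x] @ q \<equiv>\<^sub>B w @ p @ [x, y] @ q"
  proof (cases "y < x")
    case True
    then show ?thesis
      using baxter_swap[of y b x q b' "w @ p"] b b' by (simp add: min_def max_def split: if_splits)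
  next
    case False
    then show ?thesis
      using baxter_sym[OF baxter_swap[of x b y q b' "w @ p"]] b b' x(2)
      by (simp add: min_def max_def split: if_splits)
  qed
  \<comment> \<open>A Baxter swap preserves both coarser congruences, so the swapped word satisfies
    the hypotheses again, with \<open>y\<close> moved from the end of \<open>p\<close> to the front
    of \<open>q\<close>.\<close>
  have "w @ p @ x # y # q \<equiv>\<^sub>S w @ x # v"
    using sylvester_trans[OF sylvester_sym[OF baxter_imp_sylvester[OF step]] S] by simp
  moreover have "w @ p @ x # y # q \<equiv>\<^sub>S\<^sub># w @ x # v"
    using hash_sylvester_trans[OF hash_sylvester_sym[OF baxter_imp_hash_sylvester[OF step]] H]
    by simp
  ultimately have "w @ p @ x # y # q \<equiv>\<^sub>B w @ x # p @ y # q"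
    using snoc.IH x(1) by blast
  with step show ?case
    using baxter_trans by fastforce
qed

text \<open>The prefix \<open>w\<close> collects the letters already in place. Keeping it in both
  words avoids cancelling it from the congruences and leaves it available as a source of left
  witnesses.\<close>

lemma sylvester_hash_sylvester_imp_baxter:
  assumes "w @ u \<equiv>\<^sub>S w @ v" "w @ u \<equiv>\<^sub>S\<^sub># w @ v"
  shows "w @ u \<equiv>\<^sub>B w @ v"
  using assms
proof (induction v arbitrary: w u)
  case Nil
  then have "u = []"
    using sylvester_invariant(1) by fastforce
  then show ?case
    by (simp add: baxter_cong_def congruence_refl[OF congruence_generated_congruence])
next
  case (Cons x v)
  have "mset u = mset (x # v)"
    using sylvester_invariant(1)[OF Cons.prems(1)] by simp
  then have "x \<in> set u"
    by (metis list.set_intros(1) mset_eq_setD)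
  \<comment> \<open>Taking the first \<open>x\<close> in \<open>u\<close> ensures that every letter
    it passes differs from \<open>x\<close>.\<close>
  then obtain p q where u: "u = p @ x # q" and "x \<notin> set p"
    by (meson split_list_first)
  then have move: "w @ u \<equiv>\<^sub>B w @ x # p @ q"
    using baxter_move_letter Cons.prems by blast
  have "(w @ [x]) @ p @ q \<equiv>\<^sub>S (w @ [x]) @ v"
    using sylvester_trans[OF sylvester_sym[OF baxter_imp_sylvester[OF move]] Cons.prems(1)] by simp
  moreover have "(w @ [x]) @ p @ q \<equiv>\<^sub>S\<^sub># (w @ [x]) @ v"
    using hash_sylvester_trans[OF hash_sylvester_sym[OF baxter_imp_hash_sylvester[OF move]]
        Cons.prems(2)] by simp
  ultimately have "w @ x # p @ q \<equiv>\<^sub>B w @ x # v"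
    using Cons.IH[of "w @ [x]" "p @ q"] by simp
  with move show ?case
    by (rule baxter_trans)
qed

theorem proposition3p7:
  fixes letter :: "nat \<Rightarrow> 'a::linorder"
    and u v :: "'a list"
  assumes "strict_mono letter" and "range letter = UNIV"
  shows "u \<equiv>\<^sub>B v \<longleftrightarrow> u \<equiv>\<^sub>S v \<and> u \<equiv>\<^sub>S\<^sub># v"
  using baxter_imp_sylvester baxter_imp_hash_sylvester
    sylvester_hash_sylvester_imp_baxter[of "[]" u v] by auto

end
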